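(* Let $\mathcal{F} \subseteq 2^{[n]}$ be an intersecting $B$-free family with $2 \le |F| \le n/2$ for all $F \in \mathcal{F}$. Then \[ \sum_{F\in\mathcal{F}}\frac{1}{\binom{n-1}{|F|-1}}\le 2. \]
   Context: $[n]=\{1,\dots,n\}$. A family is intersecting if any two of its members have nonempty intersection. The butterfly poset $B$ has four elements $w,x,y,z$ with relations $w,x\le y,z$. A family $\mathcal{F}$ is $B$-free if there are no four distinct sets $A_1,A_2,A_3,A_4\in\mathcal{F}$ with $A_1,A_2\subseteq A_3$ and $A_1,A_2\subseteq A_4$. *)

theory Defs
  imports Complex_Main
begin

definition intersecting :: "'a set set \<Rightarrow> bool" where
  "intersecting \<F> \<longleftrightarrow> (\<forall>A\<in>\<F>. \<forall>B\<in>\<F>. A \<inter> B \<noteq> {})"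

text \<open>This is freeness in the weak sense: inclusions among the four sets beyond the ones
  listed, such as a chain \<open>A1 \<subset> A2 \<subset> A3 \<subset> A4\<close>, are forbidden as well.\<close>

definition butterfly_free :: "'a set set \<Rightarrow> bool" where
  "butterfly_free \<F> \<longleftrightarrow>
     \<not> (\<exists>A1\<in>\<F>. \<exists>A2\<in>\<F>. \<exists>A3\<in>\<F>. \<exists>A4\<in>\<F>. distinct [A1, A2, A3, A4] \<and>
          A1 \<subseteq> A3 \<and> A2 \<subseteq> A3 \<and> A1 \<subseteq> A4 \<and> A2 \<subseteq> A4)"

end

theory Submission
  imports Defs "HOL-Combinatorics.Permutations"
begin

text \<open>Katona's cycle method. Place the ground set on a cycle by a random permutation \<open>p\<close> and let \<open>G\<close> be
  the members of the family that become arcs; since \<open>F\<close> becomes an arc with probability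
  \<open>n / (n choose |F|)\<close>, it is enough to bound the mean of \<open>\<Sum>F\<in>G. 1 / |F|\<close> by 2. An intersecting antichain of
  arcs of length at most \<open>n / 2\<close> has weight at most 1, so the minimal and the maximal members of \<open>G\<close> give 2
  in total, except that a set both minimal and maximal is counted twice and a set that is neither is missed.
  Hence the bound can fail on single cycles, and has to be restored on average. By
  butterfly-freeness a set \<open>m\<close> strictly between two members has exactly one member \<open>a\<close> below and one
  member \<open>b\<close> above it, so \<open>m\<close> is an excess if \<open>m, a, b\<close> are all arcs and a gain if only \<open>m\<close> is. On average
  the gains win when \<open>P(a | m) + P(b | m) \<le> 1\<close>, and these probabilities are at most \<open>2 / |m|\<close> and
  \<open>2 / (n - |m|)\<close>. The only case left is \<open>n = 8\<close> with \<open>|a|, |m|, |b| = 2, 3, 4\<close>; there a finite check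
  shows that each excess costs only \<open>1 / 4\<close> instead of \<open>1 / 3\<close>, which exactly balances.\<close>

section \<open>Arcs of a cycle\<close>

text \<open>The cyclic interval of \<open>l\<close> points starting at \<open>t\<close>; the second
  disjunct is the part that wraps past \<open>n\<close>. Written without \<open>mod\<close>,
  membership is linear arithmetic.\<close>

definition arc :: "nat \<Rightarrow> nat \<Rightarrow> nat \<Rightarrow> nat set" where
  "arc n t l = {x \<in> {1..n}. t \<le> x \<and> x < t + l \<or> x + n < t + l}"

text \<open>Lengths 0 and \<open>n\<close> are left out so that an arc determines its starting
  point.\<close>

definition arcs :: "nat \<Rightarrow> nat set set" where
  "arcs n = {arc n t l | t l. t \<in> {1..n} \<and> 1 \<le> l \<and> l < n}"

lemma arcsE:
  assumes "X \<in> arcs n"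
  obtains t l where "X = arc n t l" "t \<in> {1..n}" "1 \<le> l" "l < n"
  using assms unfolding arcs_def by blast

lemma card_arc:
  assumes "t \<in> {1..n}" "l \<le> n"
  shows "card (arc n t l) = l"
proof -
  have "arc n t l = {t..<min (n + 1) (t + l)} \<union> {1..<t + l - n}"
    using assms by (auto simp: arc_def)
  moreover have "{t..<min (n + 1) (t + l)} \<inter> {1..<t + l - n} = {}"
    using assms by auto
  ultimately have "card (arc n t l) = card {t..<min (n + 1) (t + l)} + card {1..<t + l - n}"
    by (metis card_Un_disjoint finite_atLeastLessThan)
  then show ?thesis using assms by auto
qed

lemma arc_subset: "arc n t l \<subseteq> {1..n}"
  by (auto simp: arc_def)

lemma arcs_subset: "X \<in> arcs n \<Longrightarrow> X \<subseteq> {1..n}"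
  by (auto simp: arcs_def arc_def)

lemma finite_arcs: "finite (arcs n)"
  by (rule finite_subset[of _ "Pow {1..n}"]) (auto simp: arcs_def arc_def)

lemma arc_inject:
  assumes "t \<in> {1..n}" "t' \<in> {1..n}" "1 \<le> l" "l < n" "arc n t l = arc n t' l"
  shows "t = t'"
proof -
  \<comment> \<open>\<open>u\<close> is the cyclic predecessor of \<open>t\<close>. The start of a
    proper arc is its only point whose predecessor lies outside.\<close>
  define u where "u = (if t = 1 then n else t - 1)"
  have "t \<in> arc n t l" "u \<notin> arc n t l"
    using assms(1-4) by (auto simp: arc_def u_def)
  then have "t \<in> arc n t' l" "u \<notin> arc n t' l"
    using assms(5) by auto
  then show ?thesis
    using assms(1-4) by (auto simp: arc_def u_def split: if_splits)
qed

lemma inj_on_arc: "1 \<le> l \<Longrightarrow> l < n \<Longrightarrow> inj_on (\<lambda>t. arc n t l) {1..n}"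
  by (auto simp: inj_on_def intro: arc_inject)

lemma arcs_of_card:
  assumes "1 \<le> l" "l < n"
  shows "{X \<in> arcs n. card X = l} = (\<lambda>t. arc n t l) ` {1..n}"
proof -
  have "X \<in> (\<lambda>t. arc n t l) ` {1..n}" if "X \<in> arcs n" "card X = l" for X
  proof -
    from that obtain t k where "X = arc n t k" "t \<in> {1..n}" "k < n"
      by (auto simp: arcs_def)
    then show ?thesis using card_arc[of t n k] that by auto
  qed
  moreover have "arc n t l \<in> arcs n" "card (arc n t l) = l" if "t \<in> {1..n}" for t
    using that assms card_arc[of t n l] by (auto simp: arcs_def)
  ultimately show ?thesis by blast
qed

lemma card_arcs_of_card:
  assumes "1 \<le> l" "l < n"
  shows "card {X \<in> arcs n. card X = l} = n"
  using card_image[OF inj_on_arc[OF assms]] arcs_of_card[OF assms] by simp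

text \<open>The starts of the subarcs themselves form an arc, of length
  \<open>card X - k + 1\<close> and with the same start as \<open>X\<close>.\<close>

lemma card_subarcs:
  assumes X: "X \<in> arcs n" and k: "1 \<le> k" "k \<le> card X"
  shows "card {Y \<in> arcs n. card Y = k \<and> Y \<subseteq> X} = card X - k + 1"
proof -
  obtain t l where Xt: "X = arc n t l" and t: "t \<in> {1..n}" and l: "l < n"
    using X by (auto simp: arcs_def)
  have cX: "card X = l" using card_arc t l Xt by simp
  have "k < n" using k cX l by simp
  have sub: "arc n u k \<subseteq> X \<longleftrightarrow> t \<le> u \<and> u + k \<le> t + l \<or> u + n + k \<le> t + l"
    if u: "u \<in> {1..n}" for u
  proof
    assume *: "arc n u k \<subseteq> X"
    \<comment> \<open>\<open>v\<close> is the last point of the small arc and \<open>w\<close> the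
      point just before \<open>X\<close>. Having both ends in \<open>X\<close> is not enough: the
      small arc might leave \<open>X\<close> and come back, but then it would contain
      \<open>w\<close>.\<close>
    define v where "v = (if u + k - 1 \<le> n then u + k - 1 else u + k - 1 - n)"
    define w where "w = (if t = 1 then n else t - 1)"
    have "u \<in> arc n u k" "v \<in> arc n u k"
      using u k \<open>k < n\<close> by (auto simp: arc_def v_def)
    then have 1: "u \<in> arc n t l" "v \<in> arc n t l" using * Xt by auto
    have "w \<notin> arc n t l" using t l by (auto simp: arc_def w_def)
    then have 2: "w \<notin> arc n u k" using * Xt by auto
    show "t \<le> u \<and> u + k \<le> t + l \<or> u + n + k \<le> t + l"
      using 1 2 u t l k \<open>k < n\<close> unfolding arc_def v_def w_def
      by (auto split: if_splits)
  next
    assume "t \<le> u \<and> u + k \<le> t + l \<or> u + n + k \<le> t + l"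
    then show "arc n u k \<subseteq> X"
      using t l u unfolding Xt arc_def by auto
  qed
  have "{Y \<in> arcs n. card Y = k \<and> Y \<subseteq> X} = {Y \<in> (\<lambda>t. arc n t k) ` {1..n}. Y \<subseteq> X}"
    unfolding arcs_of_card[OF k(1) \<open>k < n\<close>, symmetric] by auto
  also have "\<dots> = (\<lambda>u. arc n u k) ` {u \<in> {1..n}. arc n u k \<subseteq> X}" by auto
  finally have "card {Y \<in> arcs n. card Y = k \<and> Y \<subseteq> X} = card {u \<in> {1..n}. arc n u k \<subseteq> X}"
    using card_image[OF inj_on_subset[OF inj_on_arc[OF k(1) \<open>k < n\<close>], of "{u \<in> {1..n}. arc n u k \<subseteq> X}"]]
    by (metis (lifting) mem_Collect_eq subsetI)
  also have "{u \<in> {1..n}. arc n u k \<subseteq> X}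
      = {u \<in> {1..n}. t \<le> u \<and> u + k \<le> t + l \<or> u + n + k \<le> t + l}"
    using sub by blast
  also have "\<dots> = arc n t (l - k + 1)"
    using t l k cX by (auto simp: arc_def)
  also have "card \<dots> = l - k + 1" using card_arc t l k cX by simp
  finally show ?thesis using cX by simp
qed

lemma card_superarcs:
  assumes X: "X \<in> arcs n" and k: "card X \<le> k" "k < n"
  shows "card {Y \<in> arcs n. card Y = k \<and> X \<subseteq> Y} = k - card X + 1"
proof -
  obtain t l where Xt: "X = arc n t l" and t: "t \<in> {1..n}" and l: "1 \<le> l" "l < n"
    using X by (auto simp: arcs_def)
  have cX: "card X = l" using card_arc t l Xt by simp
  have k1: "1 \<le> k" using k cX l by simp
  have sub: "X \<subseteq> arc n u k \<longleftrightarrow> u \<le> t \<and> t + l \<le> u + k \<or> t + n + l \<le> u + k"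
    if u: "u \<in> {1..n}" for u
  proof
    assume *: "X \<subseteq> arc n u k"
    define v where "v = (if t + l - 1 \<le> n then t + l - 1 else t + l - 1 - n)"
    define w where "w = (if u = 1 then n else u - 1)"
    have "t \<in> arc n t l" "v \<in> arc n t l"
      using t l by (auto simp: arc_def v_def)
    then have 1: "t \<in> arc n u k" "v \<in> arc n u k" using * Xt by auto
    have "w \<notin> arc n u k" using u k by (auto simp: arc_def w_def)
    then have 2: "w \<notin> arc n t l" using * Xt by auto
    show "u \<le> t \<and> t + l \<le> u + k \<or> t + n + l \<le> u + k"
      using 1 2 u t l k unfolding arc_def v_def w_def
      by (auto split: if_splits)
  next
    assume "u \<le> t \<and> t + l \<le> u + k \<or> t + n + l \<le> u + k"
    then show "X \<subseteq> arc n u k"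
      using t l u unfolding Xt arc_def by auto
  qed
  \<comment> \<open>The starts of the superarcs form an arc that ends at \<open>t\<close>; its first
    point \<open>s\<close> lies \<open>k - l\<close> places before \<open>t\<close>.\<close>
  define s where "s = (if k - l < t then t - (k - l) else t + n - (k - l))"
  have s: "s \<in> {1..n}" using t k cX by (auto simp: s_def)
  have "{Y \<in> arcs n. card Y = k \<and> X \<subseteq> Y} = {Y \<in> (\<lambda>t. arc n t k) ` {1..n}. X \<subseteq> Y}"
    unfolding arcs_of_card[OF k1 k(2), symmetric] by auto
  also have "\<dots> = (\<lambda>u. arc n u k) ` {u \<in> {1..n}. X \<subseteq> arc n u k}" by auto
  finally have "card {Y \<in> arcs n. card Y = k \<and> X \<subseteq> Y} = card {u \<in> {1..n}. X \<subseteq> arc n u k}"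
    using card_image[OF inj_on_subset[OF inj_on_arc[OF k1 k(2)], of "{u \<in> {1..n}. X \<subseteq> arc n u k}"]]
    by (metis (lifting) mem_Collect_eq subsetI)
  also have "{u \<in> {1..n}. X \<subseteq> arc n u k}
      = {u \<in> {1..n}. u \<le> t \<and> t + l \<le> u + k \<or> t + n + l \<le> u + k}"
    using sub by blast
  also have "\<dots> = arc n s (k - l + 1)"
    using t l k cX by (auto simp: arc_def s_def)
  also have "card \<dots> = k - l + 1" using card_arc[OF s] l k cX by simp
  finally show ?thesis using cX by simp
qed

section \<open>Rotations of the cycle\<close>

definition rot :: "nat \<Rightarrow> nat \<Rightarrow> nat \<Rightarrow> nat" where
  "rot n s x = (if x + s \<le> n then x + s else x + s - n)"

lemma rot_image_arc:
  assumes "s < n" "t \<in> {1..n}" "l \<le> n"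
  shows "rot n s ` arc n t l = arc n (rot n s t) l"
proof
  show "rot n s ` arc n t l \<subseteq> arc n (rot n s t) l"
    using assms by (auto simp: arc_def rot_def)
  show "arc n (rot n s t) l \<subseteq> rot n s ` arc n t l"
  proof
    fix x assume x: "x \<in> arc n (rot n s t) l"
    define y where "y = (if s < x then x - s else x + n - s)"
    have "y \<in> arc n t l" "x = rot n s y"
      using x assms by (auto simp: arc_def rot_def y_def split: if_splits)
    then show "x \<in> rot n s ` arc n t l" by blast
  qed
qed

text \<open>Normalisation: a rotation permutes the arcs, so after composing \<open>p\<close> with
  one, a chosen member may be taken to be the image of an arc starting at 1.\<close>

lemma rotate_arcs:
  assumes p: "inj_on p {1..n}" and s: "s \<in> {1..n}"
  obtains q where "inj_on q {1..n}" "\<And>l. l \<le> n \<Longrightarrow> q ` arc n 1 l = p ` arc n s l"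
    "(`) q ` arcs n = (`) p ` arcs n"
proof
  let ?r = "rot n (s - 1)"
  have img: "?r ` {1..n} = {1..n}"
  proof -
    \<comment> \<open>The whole ground set is the arc of length \<open>n\<close>, so surjectivity is
      an instance of \<open>rot_image_arc\<close>.\<close>
    have "arc n 1 n = {1..n}" "arc n s n = {1..n}" "?r 1 = s"
      using s by (auto simp: arc_def rot_def)
    moreover have "s - 1 < n" "1 \<in> {1..n}" using s by auto
    ultimately show ?thesis using rot_image_arc[of "s - 1" n 1 n] by (simp only: le_refl simp_thms)
  qed
  have "inj_on ?r {1..n}"
    by (intro eq_card_imp_inj_on) (simp_all only: img finite_atLeastAtMost)
  then show "inj_on (p \<circ> ?r) {1..n}"
    by (rule comp_inj_on) (simp only: img p)
  show "(p \<circ> ?r) ` arc n 1 l = p ` arc n s l" if "l \<le> n" for l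
  proof -
    have "?r 1 = s" "s - 1 < n" "1 \<in> {1..n}" using s by (auto simp: rot_def)
    then have "?r ` arc n 1 l = arc n s l" using rot_image_arc[of "s - 1" n 1 l] that by metis
    then show ?thesis by (metis image_comp)
  qed
  have "(`) ?r ` arcs n = arcs n"
  proof -
    have "?r ` X \<in> arcs n" if "X \<in> arcs n" for X
    proof -
      from that obtain t l where "X = arc n t l" "t \<in> {1..n}" "1 \<le> l" "l < n"
        by (auto simp: arcs_def)
      moreover have "?r t \<in> {1..n}" using img \<open>t \<in> {1..n}\<close> by blast
      moreover have "s - 1 < n" using s by auto
      ultimately have "?r ` X = arc n (?r t) l" "?r t \<in> {1..n}" "1 \<le> l" "l < n"
        using rot_image_arc[of "s - 1" n t l] by auto
      then show ?thesis unfolding arcs_def by blast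
    qed
    moreover have "X \<in> (`) ?r ` arcs n" if "X \<in> arcs n" for X
    proof -
      from that obtain t l where X: "X = arc n t l" "t \<in> {1..n}" "1 \<le> l" "l < n"
        by (auto simp: arcs_def)
      obtain u where u: "u \<in> {1..n}" "t = ?r u" using img X(2) by blast
      have "s - 1 < n" using s by auto
      then have "?r ` arc n u l = X" using rot_image_arc[of "s - 1" n u l] u X by simp
      moreover have "arc n u l \<in> arcs n" using u X unfolding arcs_def by blast
      ultimately show ?thesis by blast
    qed
    ultimately show ?thesis by blast
  qed
  moreover have "(`) (p \<circ> ?r) ` arcs n = (`) p ` (`) ?r ` arcs n"
    by (simp add: image_image comp_def)
  ultimately show "(`) (p \<circ> ?r) ` arcs n = (`) p ` arcs n" by simp
qed

section \<open>Katona's bound for intersecting antichains of arcs\<close>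

text \<open>Let \<open>k\<close> be the least size. The other members cut a smallest member at
  distinct ones of its \<open>k - 1\<close> interior gaps, so there are at most \<open>k\<close>
  members, each of weight at most \<open>1 / k\<close>.\<close>

lemma arc_antichain_sum:
  fixes G :: "'a set set"
  assumes p: "inj_on p {1..n}" and G: "G \<subseteq> (`) p ` arcs n"
    and int: "intersecting G"
    and anti: "\<And>X Y. X \<in> G \<Longrightarrow> Y \<in> G \<Longrightarrow> X \<subseteq> Y \<Longrightarrow> X = Y"
    and half: "\<And>X. X \<in> G \<Longrightarrow> 2 * card X \<le> n"
  shows "(\<Sum>X\<in>G. 1 / real (card X)) \<le> 1"
proof (cases "G = {}")
  case False
  have fin: "finite G" using finite_subset[OF G] finite_arcs by simp
  obtain G0 where G0: "G0 \<in> G" and min: "\<And>X. X \<in> G \<Longrightarrow> card G0 \<le> card X"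
    using arg_min_if_finite(1)[OF fin False, of card] arg_min_least[OF fin False, of _ card] by blast
  define k where "k = card G0"
  obtain s l where sl: "G0 = p ` arc n s l" "s \<in> {1..n}" "1 \<le> l" "l < n"
    using G0 G by (blast elim: arcsE)
  have card_p: "card (p ` X) = card X" if "X \<subseteq> {1..n}" for X
    using p that by (meson card_image inj_on_subset)
  have "l = k" using sl card_arc[of s n l] card_p[OF arc_subset] by (simp add: k_def)
  have k: "1 \<le> k" "k < n" using sl \<open>l = k\<close> by auto
  obtain q where q: "inj_on q {1..n}" "q ` arc n 1 k = G0" "G \<subseteq> (`) q ` arcs n"
  proof -
    obtain q where "inj_on q {1..n}" "\<And>l. l \<le> n \<Longrightarrow> q ` arc n 1 l = p ` arc n s l"
      "(`) q ` arcs n = (`) p ` arcs n" by (rule rotate_arcs[OF p sl(2)]) blast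
    then show ?thesis using that[of q] sl \<open>l = k\<close> G by simp
  qed
  have card_q: "card (q ` arc n t l) = l" if "t \<in> {1..n}" "l \<le> n" for t l
    using card_arc[OF that] card_image[OF inj_on_subset[OF q(1) arc_subset]] by metis
  have int_q: "X \<inter> Y \<noteq> {}" if "q ` X \<in> G" "q ` Y \<in> G" "X \<subseteq> {1..n}" "Y \<subseteq> {1..n}" for X Y
  proof
    assume "X \<inter> Y = {}"
    then have "q ` X \<inter> q ` Y = {}" using inj_on_image_Int[OF q(1) that(3,4)] by simp
    then show False using int that(1,2) unfolding intersecting_def by blast
  qed
  text \<open>A member other than \<open>G0\<close> has exactly one end strictly inside \<open>G0\<close>; two members that cut
    \<open>G0\<close> at the same place are comparable or disjoint.\<close>
  define cut where "cut i X \<longleftrightarrow> (\<exists>t\<in>{1..n}. \<exists>l<n. X = q ` arc n t l \<and> 1 \<le> l \<and>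
      (t = i + 1 \<or> t + l = n + i + 1))" for i X
  have ex: "\<exists>i. i \<in> {1..<k} \<and> cut i X" if X: "X \<in> G - {G0}" for X
  proof -
    obtain t l where tl: "X = q ` arc n t l" "t \<in> {1..n}" "1 \<le> l" "l < n"
      using X q(3) by (blast elim: arcsE)
    \<comment> \<open>An arc contains \<open>{1..k}\<close> if it starts at 1 with length at least
      \<open>k\<close>, or wraps round as far as \<open>k\<close>. Excluding both puts the gap index
      into \<open>{1..<k}\<close>.\<close>
    have "\<not> arc n 1 k \<subseteq> arc n t l"
      using anti[OF G0, of X] X q(2) tl(1) by blast
    then have nsub: "\<not> (t = 1 \<and> k \<le> l)" "\<not> (n + k + 1 \<le> t + l)"
      by (auto simp: arc_def)
    have "k \<le> l" using min[of X] X tl card_q by (simp add: k_def)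
    obtain x where "x \<in> arc n 1 k" "x \<in> arc n t l"
      using int_q[of "arc n 1 k" "arc n t l"] X G0 q(2) tl(1) arc_subset by auto
    then have "t \<le> k \<or> n + 1 < t + l" by (auto simp: arc_def)
    then show ?thesis
    proof
      assume "t \<le> k"
      then show ?thesis using tl nsub \<open>k \<le> l\<close>
        by (intro exI[of _ "t - 1"]) (auto simp: cut_def intro!: bexI[of _ t] exI[of _ l])
    next
      assume "n + 1 < t + l"
      then show ?thesis using tl nsub \<open>k \<le> l\<close>
        by (intro exI[of _ "t + l - n - 1"]) (auto simp: cut_def intro!: bexI[of _ t] exI[of _ l])
    qed
  qed
  have uniq: "X = Y" if X: "X \<in> G" "cut i X" and Y: "Y \<in> G" "cut i Y" and i: "i \<in> {1..<k}" for X Y i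
  proof -
    obtain t l where tl: "X = q ` arc n t l" "t \<in> {1..n}" "1 \<le> l" "l < n" "t = i + 1 \<or> t + l = n + i + 1"
      using X by (auto simp: cut_def)
    obtain u m where um: "Y = q ` arc n u m" "u \<in> {1..n}" "1 \<le> m" "m < n" "u = i + 1 \<or> u + m = n + i + 1"
      using Y by (auto simp: cut_def)
    have "2 * l \<le> n" "2 * m \<le> n" 
      using half[OF X(1)] half[OF Y(1)] tl(1-4) um(1-4) card_q by auto
    obtain x where x: "x \<in> arc n t l" "x \<in> arc n u m"
      using int_q[of "arc n t l" "arc n u m"] X Y tl um arc_subset by auto
    \<comment> \<open>Here the length bound enters: if one arc ended at the gap and the other
      started there, their total length would be at most \<open>n\<close> and they would be
      disjoint.\<close>
    have "t = u \<or> t + l = u + m"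
      using x tl(2-5) um(2-5) \<open>2 * l \<le> n\<close> \<open>2 * m \<le> n\<close> i by (auto simp: arc_def)
    then have "arc n t l \<subseteq> arc n u m \<or> arc n u m \<subseteq> arc n t l"
      using tl(2-5) um(2-5) by (auto simp: arc_def)
    then have "X \<subseteq> Y \<or> Y \<subseteq> X" using tl um by blast
    then show ?thesis using anti X Y by blast
  qed
  obtain f where f: "\<And>X. X \<in> G - {G0} \<Longrightarrow> f X \<in> {1..<k} \<and> cut (f X) X"
    using ex by metis
  have "inj_on f (G - {G0})" 
  proof (rule inj_onI)
    fix X Y assume "X \<in> G - {G0}" "Y \<in> G - {G0}" "f X = f Y"
    then show "X = Y" using uniq[of X "f X" Y] f[of X] f[of Y] by simp
  qed
  moreover have "f ` (G - {G0}) \<subseteq> {1..<k}" using f by blast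
  ultimately have "card (G - {G0}) \<le> card {1..<k}"
    using card_inj_on_le finite_atLeastLessThan by blast
  then have "card G \<le> k" using fin G0 k by (auto simp: card_Diff_singleton)
  have "(\<Sum>X\<in>G. 1 / real (card X)) \<le> (\<Sum>X\<in>G. 1 / real k)"
    using min k by (intro sum_mono) (auto simp: frac_le k_def)
  also have "\<dots> \<le> 1" using \<open>card G \<le> k\<close> k by (simp add: divide_le_eq)
  finally show ?thesis .
qed simp


section \<open>Permutations acting on the subsets of a given size\<close>

lemma ex_permutes_image:
  assumes "finite D" "A \<subseteq> D" "B \<subseteq> D" "card A = card B"
  shows "\<exists>q. q permutes D \<and> q ` A = B"
proof -
  have fin: "finite A" "finite B" using assms finite_subset by auto
  obtain f where f: "bij_betw f A B" using finite_same_card_bij fin assms(4) by blast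
  have "card (D - A) = card (D - B)" using assms fin by (simp add: card_Diff_subset)
  then obtain g where g: "bij_betw g (D - A) (D - B)"
    using finite_same_card_bij[of "D - A" "D - B"] assms(1) by auto
  define q where "q x = (if x \<in> A then f x else if x \<in> D then g x else x)" for x
  have qA: "bij_betw q A B" using f by (subst bij_betw_cong[of A q f]) (auto simp: q_def)
  have "bij_betw q (D - A) (D - B)" using g by (subst bij_betw_cong[of "D - A" q g]) (auto simp: q_def)
  then have "bij_betw q (A \<union> (D - A)) (B \<union> (D - B))" using qA by (intro bij_betw_combine) auto
  then have "bij_betw q D D" using assms(2,3) by (simp add: Un_absorb1)
  then have "q permutes D" using assms(2) by (intro bij_imp_permutes) (auto simp: q_def)
  moreover have "q ` A = B" using qA by (simp add: bij_betw_def)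
  ultimately show ?thesis by blast
qed

text \<open>All the sets that agree with \<open>A\<close> outside \<open>D\<close> and have the same size are equally likely as images of \<open>X\<close>,
  since permutations of \<open>D\<close> act transitively on them.\<close>

lemma card_permutes_image:
  assumes fin: "finite U" and D: "D \<subseteq> U" and S: "S \<subseteq> {p. p permutes U}"
    and closed: "\<And>p q. p \<in> S \<Longrightarrow> q permutes D \<Longrightarrow> q \<circ> p \<in> S"
    and out: "\<And>p. p \<in> S \<Longrightarrow> p ` X - D = A - D"
    and A: "A \<subseteq> U" and card: "card A = card X"
  shows "card S = (card D choose card (A \<inter> D)) * card {p \<in> S. p ` X = A}"
proof -
  have finD: "finite D" using fin D finite_subset by blast
  have finS: "finite S" using S fin finite_permutations finite_subset by blast
  define N where "N E = {p \<in> S. p ` X \<inter> D = E}" for E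
  have finN: "finite (N E)" for E using finS by (simp add: N_def)
  \<comment> \<open>Composition with \<open>q\<close> is injective. Used for both \<open>q\<close>
    and \<open>inv q\<close>, this gives equality of the counts.\<close>
  have le: "card (N E) \<le> card (N (q ` E))" if q: "q permutes D" for q E
  proof (rule card_inj_on_le)
    show "inj_on (\<lambda>p. q \<circ> p) (N E)"
      by (rule inj_on_inverseI[of _ "\<lambda>r. inv q \<circ> r"]) (simp add: o_assoc permutes_inv_o[OF q])
    show "(\<lambda>p. q \<circ> p) ` N E \<subseteq> N (q ` E)"
    proof safe
      fix p assume p: "p \<in> N E"
      have "(q \<circ> p) ` X \<inter> D = q ` (p ` X) \<inter> q ` D" using permutes_image[OF q] by (simp add: image_comp)
      also have "\<dots> = q ` (p ` X \<inter> D)" using permutes_inj[OF q] by (simp add: image_Int)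
      finally show "q \<circ> p \<in> N (q ` E)" using p closed q by (auto simp: N_def)
    qed
  qed (rule finN)
  have eq: "card (N E) = card (N (A \<inter> D))" if E: "E \<subseteq> D" "card E = card (A \<inter> D)" for E
  proof -
    obtain q where q: "q permutes D" "q ` E = A \<inter> D"
      using ex_permutes_image[OF finD E(1) _ E(2)] by blast
    have "inv q ` (A \<inter> D) = E" using q permutes_inj[OF q(1)] by (metis image_inv_f_f)
    then show ?thesis using le[OF q(1), of E] le[OF permutes_inv[OF q(1)], of "A \<inter> D"] q(2) by simp
  qed
  have NA: "N (A \<inter> D) = {p \<in> S. p ` X = A}" using out unfolding N_def by blast
  \<comment> \<open>The part of the image outside \<open>D\<close> is prescribed, so its part inside
    \<open>D\<close> always has \<open>card (A \<inter> D)\<close> points.\<close>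
  have cover: "S = (\<Union>E\<in>{E. E \<subseteq> D \<and> card E = card (A \<inter> D)}. N E)"
  proof -
    have "card (p ` X \<inter> D) = card (A \<inter> D)" if p: "p \<in> S" for p
    proof -
      have pp: "p permutes U" using S p by blast
      have finA: "finite A" using A fin finite_subset by blast
      have c: "card (p ` X) = card A"
        using card card_image[OF permutes_inj_on[OF pp]] by metis
      \<comment> \<open>\<open>card\<close> is 0 for infinite sets too, so in that case finiteness
        is read off from the prescribed part outside \<open>D\<close>.\<close>
      have finpX: "finite (p ` X)"
      proof (cases "card A = 0")
        case True
        have "p ` X \<subseteq> D \<union> (A - D)" using out[OF p] by blast
        then show ?thesis using finD finA finite_subset by blast
      next
        case False
        then show ?thesis using c card.infinite by metis
      qed
      have "card (p ` X \<inter> D) = card (p ` X) - card (p ` X - D)"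
        using finpX by (metis card_Diff_subset_Int card_Int_Diff Diff_Diff_Int add_diff_cancel_right')
      also have "\<dots> = card (A \<inter> D)"
        using finA out[OF p] c by (metis card_Int_Diff add_diff_cancel_right')
      finally show ?thesis .
    qed
    then show ?thesis by (auto simp: N_def)
  qed
  have "card S = (\<Sum>E | E \<subseteq> D \<and> card E = card (A \<inter> D). card (N E))"
    by (subst cover, rule card_UN_disjoint) (use finD finN in \<open>auto simp: N_def\<close>)
  also have "\<dots> = (\<Sum>E | E \<subseteq> D \<and> card E = card (A \<inter> D). card (N (A \<inter> D)))"
    by (rule sum.cong[OF refl]) (use eq in blast)
  also have "\<dots> = card {E. E \<subseteq> D \<and> card E = card (A \<inter> D)} * card (N (A \<inter> D))"
    by simp
  also have "card {E. E \<subseteq> D \<and> card E = card (A \<inter> D)} = card D choose card (A \<inter> D)"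
    by (rule n_subsets[OF finD])
  finally show ?thesis by (simp add: NA)
qed

section \<open>Weights of families of arcs\<close>

definition mid :: "'a set set \<Rightarrow> 'a set set" where
  "mid G = {X \<in> G. (\<exists>Y\<in>G. Y \<subset> X) \<and> (\<exists>Z\<in>G. X \<subset> Z)}"

definition isol :: "'a set set \<Rightarrow> 'a set set" where
  "isol G = {X \<in> G. \<not> (\<exists>Y\<in>G. Y \<subset> X) \<and> \<not> (\<exists>Z\<in>G. X \<subset> Z)}"

lemma intersecting_subset: "intersecting G \<Longrightarrow> H \<subseteq> G \<Longrightarrow> intersecting H"
  unfolding intersecting_def by blast

text \<open>The minimal and the maximal members form two intersecting antichains of arcs, each of
  weight at most 1. They overlap in \<open>isol G\<close> and together miss exactly
  \<open>mid G\<close>.\<close>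

lemma arcs_sum_le:
  fixes G :: "'a set set"
  assumes p: "inj_on p {1..n}" and G: "G \<subseteq> (`) p ` arcs n"
    and int: "intersecting G" and half: "\<And>X. X \<in> G \<Longrightarrow> 2 * card X \<le> n"
  shows "(\<Sum>X\<in>G. 1 / real (card X))
    \<le> 2 + (\<Sum>X\<in>mid G. 1 / real (card X)) - (\<Sum>X\<in>isol G. 1 / real (card X))"
proof -
  let ?s = "sum (\<lambda>X. 1 / real (card X))"
  define L where "L = {X \<in> G. \<not> (\<exists>Y\<in>G. Y \<subset> X)}"
  define U where "U = {X \<in> G. \<not> (\<exists>Z\<in>G. X \<subset> Z)}"
  have fin: "finite G" using finite_subset[OF G] finite_arcs by simp
  have sub: "L \<subseteq> G" "U \<subseteq> G" by (auto simp: L_def U_def)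
  then have finLU: "finite L" "finite U" using fin finite_subset by auto
  have "?s L \<le> 1"
    by (rule arc_antichain_sum[OF p _ intersecting_subset[OF int sub(1)]])
      (use G half in \<open>auto simp: L_def\<close>)
  moreover have "?s U \<le> 1"
    by (rule arc_antichain_sum[OF p _ intersecting_subset[OF int sub(2)]])
      (use G half in \<open>auto simp: U_def\<close>)
  moreover have "?s L + ?s U = ?s (L \<union> U) + ?s (L \<inter> U)"
    using sum.union_inter[OF finLU] by metis
  moreover have "L \<inter> U = isol G" by (auto simp: L_def U_def isol_def)
  moreover have "?s G = ?s (L \<union> U) + ?s (mid G)"
  proof -
    have "G = (L \<union> U) \<union> mid G" "(L \<union> U) \<inter> mid G = {}"
      unfolding L_def U_def mid_def by blast+
    then show ?thesis using sum.union_disjoint[of "L \<union> U" "mid G"] finLU fin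
      by (metis finite_Un)
  qed
  ultimately show ?thesis by simp
qed

section \<open>Explicit sums over arcs, and the cycle of length 8\<close>

lemma inj_on_arc_image:
  assumes "inj_on p {1..n}"
  shows "inj_on (\<lambda>(t, l). p ` arc n t l) ({1..n} \<times> {1..<n})"
proof (rule inj_onI, clarify)
  fix t l u k
  assume "t \<in> {1..n}" "u \<in> {1..n}" "l \<in> {1..<n}" "k \<in> {1..<n}" "p ` arc n t l = p ` arc n u k"
  moreover from this have "arc n t l = arc n u k"
    using inj_on_image_eq_iff[OF assms arc_subset arc_subset] by blast
  moreover from calculation have "l = k" using card_arc[of t n l] card_arc[of u n k] by auto
  ultimately show "t = u \<and> l = k" using arc_inject[of t n u l] by auto
qed

text \<open>Indexes a family by start and length, so that weights on a small cycle can be written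
  out term by term.\<close>

lemma sum_arc_images:
  fixes g :: "'a set \<Rightarrow> real"
  assumes p: "inj_on p {1..n}" and G: "G \<subseteq> (`) p ` arcs n"
    and L: "L \<subseteq> {1..<n}" "\<And>X. X \<in> G \<Longrightarrow> card X \<in> L"
  shows "sum g G = (\<Sum>l\<in>L. \<Sum>t\<in>{1..n}. if p ` arc n t l \<in> G then g (p ` arc n t l) else 0)"
proof -
  let ?e = "\<lambda>(t, l). p ` arc n t l"
  have inj: "inj_on ?e ({1..n} \<times> L)"
    by (rule inj_on_subset[OF inj_on_arc_image[OF p]]) (use L(1) in auto)
  have finL: "finite L" using finite_subset[OF L(1)] by simp
  have sub: "G \<subseteq> ?e ` ({1..n} \<times> L)"
  proof
    fix X assume X: "X \<in> G"
    then obtain t l where tl: "X = p ` arc n t l" "t \<in> {1..n}" "l < n"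
      using G by (blast elim: arcsE)
    have "card X = l"
      using card_arc[of t n l] tl card_image[OF inj_on_subset[OF p arc_subset]] by auto
    then have "X = ?e (t, l)" "(t, l) \<in> {1..n} \<times> L" using tl L(2)[OF X] by auto
    then show "X \<in> ?e ` ({1..n} \<times> L)" by (rule image_eqI)
  qed
  have "sum g G = (\<Sum>X\<in>?e ` ({1..n} \<times> L). if X \<in> G then g X else 0)"
    using sum.inter_restrict[of "?e ` ({1..n} \<times> L)" g G] finL Int_absorb1[OF sub] by simp
  also have "\<dots> = (\<Sum>(t, l)\<in>{1..n} \<times> L. if p ` arc n t l \<in> G then g (p ` arc n t l) else 0)"
    by (subst sum.reindex[OF inj]) (auto intro!: sum.cong)
  also have "\<dots> = (\<Sum>t\<in>{1..n}. \<Sum>l\<in>L. if p ` arc n t l \<in> G then g (p ` arc n t l) else 0)"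
    by (simp add: sum.cartesian_product)
  finally show ?thesis by (subst sum.swap)
qed

text \<open>Here \<open>atl\<close> stands for membership of the arc of length \<open>l\<close> starting at \<open>t\<close> in a family of arcs of
  \<open>{1..8}\<close> that contains \<open>{1, 2}\<close>. The assumptions are those instances of the intersection and butterfly
  conditions that a computer search found to suffice; the last two brackets count the triples strictly between
  two members and the isolated triples.\<close>

lemma octagon_bool:
  assumes "\<not> (a22 \<and> a73)" "\<not> (a22 \<and> a82)" "\<not> (a23 \<and> a64)" "\<not> (a23 \<and> a73)" "\<not> (a23 \<and> a82)"
    "\<not> (a24 \<and> a64)" "\<not> (a24 \<and> a73)" "\<not> (a22 \<and> a14 \<and> a84)" "\<not> (a82 \<and> a74 \<and> a84)"
  shows "1 / 2 * (1 + of_bool a22 + of_bool a82)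
      + 1 / 3 * (of_bool a13 + of_bool a23 + of_bool a73 + of_bool a83)
      + 1 / 4 * (of_bool a14 + of_bool a24 + of_bool a64 + of_bool a74 + of_bool a84)
    \<le> 2 + 1 / 4 * (of_bool (a13 \<and> (a14 \<or> a84)) + of_bool (a83 \<and> (a84 \<or> a74))
        + of_bool (a73 \<and> a82 \<and> (a64 \<or> a74)) + of_bool (a23 \<and> a22 \<and> (a14 \<or> a24)))
      - 1 / 3 * (of_bool (a23 \<and> \<not> a22 \<and> \<not> a14 \<and> \<not> a24)
        + (of_bool (a73 \<and> \<not> a82 \<and> \<not> a64 \<and> \<not> a74)) :: real)"
  using assms
  by (cases a22; cases a82; cases a23; cases a73; simp)

text \<open>Without a pair, sizes 3 and 4 leave no room for middle sets, and
  \<open>arcs_sum_le\<close> suffices. Otherwise a pair is rotated to \<open>{1, 2}\<close>; by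
  intersection only 12 arcs can then be members, and \<open>octagon_bool\<close> applies to
  them.\<close>

lemma octagon_sum_le:
  fixes G :: "'a set set"
  assumes p: "inj_on p {1..8::nat}" and G: "G \<subseteq> (`) p ` arcs 8"
    and int: "intersecting G" and bf: "butterfly_free G"
    and card: "\<And>X. X \<in> G \<Longrightarrow> card X \<in> {2, 3, 4}"
  shows "(\<Sum>X\<in>G. 1 / real (card X))
    \<le> 2 + (\<Sum>X\<in>mid G. 1 / 4) - (\<Sum>X\<in>{X \<in> isol G. card X = 3}. 1 / real (card X))"
proof (cases "\<exists>X\<in>G. card X = 2")
  case False
  have finG: "finite G" using finite_subset[OF G] finite_arcs by simp
  have fin: "finite X" if "X \<in> G" for X using card[OF that] card.infinite[of X] by fastforce
  have "mid G = {}"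
  proof (rule ccontr)
    assume "mid G \<noteq> {}"
    then obtain X Y Z where X: "X \<in> G" "Y \<in> G" "Z \<in> G" "Y \<subset> X" "X \<subset> Z"
      by (auto simp: mid_def)
    then have "card Y < card X" "card X < card Z" using fin psubset_card_mono by blast+
    then show False using False card[OF X(1)] card[OF X(2)] card[OF X(3)] X(2) by auto
  qed
  \<comment> \<open>Isolated sets of other sizes are discarded, which only weakens the
    bound.\<close>
  moreover have "(\<Sum>X\<in>{X \<in> isol G. card X = 3}. 1 / real (card X)) \<le> (\<Sum>X\<in>isol G. 1 / real (card X))"
    by (rule sum_mono2) (use finG in \<open>auto simp: isol_def\<close>)
  ultimately show ?thesis
    using arcs_sum_le[OF p G int] card by fastforce
next
  case True
  then obtain X0 where X0: "X0 \<in> G" "card X0 = 2" by blast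
  obtain s l where sl: "X0 = p ` arc 8 s l" "s \<in> {1..8}" "1 \<le> l" "l < 8"
    using X0 G by (blast elim: arcsE)
  have "l = 2" using sl X0 card_arc[of s 8 l] card_image[OF inj_on_subset[OF p arc_subset]] by auto
  obtain q where q: "inj_on q {1..8::nat}" "q ` arc 8 1 2 = X0" "G \<subseteq> (`) q ` arcs 8"
  proof -
    obtain q where "inj_on q {1..8::nat}" "\<And>l. l \<le> 8 \<Longrightarrow> q ` arc 8 1 l = p ` arc 8 s l"
      "(`) q ` arcs 8 = (`) p ` arcs 8" by (rule rotate_arcs[OF p sl(2)]) blast
    then show ?thesis using that[of q] sl \<open>l = 2\<close> G by simp
  qed
  \<comment> \<open>\<open>y t l\<close> plays the role of \<open>atl\<close> in
    \<open>octagon_bool\<close>.\<close>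
  define y where "y t l \<longleftrightarrow> q ` arc 8 t l \<in> G" for t l
  have card_q: "card (q ` arc 8 t l) = l" if "t \<in> {1..8}" "l \<le> 8" for t l
    using card_arc[OF that] card_image[OF inj_on_subset[OF q(1) arc_subset]] by simp
  have meet: "arc 8 t l \<inter> arc 8 u k \<noteq> {}" if "y t l" "y u k" for t l u k
  proof
    assume "arc 8 t l \<inter> arc 8 u k = {}"
    then have "q ` arc 8 t l \<inter> q ` arc 8 u k = {}"
      using inj_on_image_Int[OF q(1) arc_subset arc_subset] by (metis image_empty)
    then show False using int that unfolding intersecting_def y_def by blast
  qed
  have y12: "y 1 2" using q(2) X0 by (simp add: y_def)
  \<comment> \<open>Such an arc starts after 2 and ends by 8, so it misses
    \<open>{1, 2}\<close>.\<close>
  have none: "\<not> y t l" if "3 \<le> t" "t + l \<le> 9" for t l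
    using meet[OF _ y12, of t l] that by (auto simp: arc_def)
  have ne: "q ` arc 8 t l \<noteq> q ` arc 8 u k"
    if "t \<in> {1..8}" "u \<in> {1..8}" "l \<in> {1..<8}" "k \<in> {1..<8}" "(t, l) \<noteq> (u, k)" for t l u k
    using inj_onD[OF inj_on_arc_image[OF q(1)], of "(t, l)" "(u, k)"] that by auto
  have butterfly: False
    if "A \<in> G" "B \<in> G" "C \<in> G" "D \<in> G" "distinct [A, B, C, D]"
      "A \<subseteq> C" "B \<subseteq> C" "A \<subseteq> D" "B \<subseteq> D" for A B C D
    using bf that unfolding butterfly_free_def by blast
  \<comment> \<open>Before applying \<open>q\<close>, the butterfly consists of
    \<open>{1, 2}\<close> and \<open>{2, 3}\<close> below \<open>{1, 2, 3, 4}\<close> and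
    \<open>{8, 1, 2, 3}\<close>; \<open>b2\<close> is its mirror image.\<close>
  have b1: "\<not> (y 2 2 \<and> y 1 4 \<and> y 8 4)"
  proof
    assume "y 2 2 \<and> y 1 4 \<and> y 8 4"
    then show False
      using y12 unfolding y_def
      by (intro butterfly[of "q ` arc 8 1 2" "q ` arc 8 2 2" "q ` arc 8 1 4" "q ` arc 8 8 4"] image_mono)
        (auto simp: ne simp del: One_nat_def, auto simp: arc_def)
  qed
  have b2: "\<not> (y 8 2 \<and> y 7 4 \<and> y 8 4)"
  proof
    assume "y 8 2 \<and> y 7 4 \<and> y 8 4"
    then show False
      using y12 unfolding y_def
      by (intro butterfly[of "q ` arc 8 1 2" "q ` arc 8 8 2" "q ` arc 8 7 4" "q ` arc 8 8 4"] image_mono)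
        (auto simp: ne simp del: One_nat_def, auto simp: arc_def)
  qed
  have i: "\<not> (y 2 2 \<and> y 7 3)" "\<not> (y 2 2 \<and> y 8 2)" "\<not> (y 2 3 \<and> y 6 4)" "\<not> (y 2 3 \<and> y 7 3)"
    "\<not> (y 2 3 \<and> y 8 2)" "\<not> (y 2 4 \<and> y 6 4)" "\<not> (y 2 4 \<and> y 7 3)"
    using meet[of 2 2 7 3] meet[of 2 2 8 2] meet[of 2 3 6 4] meet[of 2 3 7 3]
      meet[of 2 3 8 2] meet[of 2 4 6 4] meet[of 2 4 7 3] by (auto simp: arc_def)
  have I8: "{1..8::nat} = {1, 2, 3, 4, 5, 6, 7, 8}" by auto
  have strict: "q ` arc 8 t l \<subset> q ` arc 8 u k"
    if "arc 8 t l \<subseteq> arc 8 u k" "t \<in> {1..8}" "u \<in> {1..8}" "l < k" "k \<le> 8" for t l u k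
    using image_mono[OF that(1), of q] card_q[of t l] card_q[of u k] that by (auto simp: psubset_eq)
  have sG: "(\<Sum>X\<in>G. 1 / real (card X)) = 1 / 2 * (1 + of_bool (y 2 2) + of_bool (y 8 2))
      + 1 / 3 * (of_bool (y 1 3) + of_bool (y 2 3) + of_bool (y 7 3) + of_bool (y 8 3))
      + 1 / 4 * (of_bool (y 1 4) + of_bool (y 2 4) + of_bool (y 6 4) + of_bool (y 7 4) + of_bool (y 8 4))"
  proof -
    have "(\<Sum>X\<in>G. 1 / real (card X)) = (\<Sum>l\<in>{2,3,4}. \<Sum>t\<in>{1..8}. if y t l then 1 / real (card (q ` arc 8 t l)) else 0)"
      unfolding y_def by (rule sum_arc_images[OF q(1,3)]) (use card in auto)
    also have "\<dots> = (\<Sum>l\<in>{2,3,4}. \<Sum>t\<in>{1..8}. of_bool (y t l) / real l)"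
      by (intro sum.cong refl) (auto simp: card_q)
    also have "\<dots> = 1 / 2 * (1 + of_bool (y 2 2) + of_bool (y 8 2))
      + 1 / 3 * (of_bool (y 1 3) + of_bool (y 2 3) + of_bool (y 7 3) + of_bool (y 8 3))
      + 1 / 4 * (of_bool (y 1 4) + of_bool (y 2 4) + of_bool (y 6 4) + of_bool (y 7 4) + of_bool (y 8 4))"
      unfolding I8 using y12 none by (simp add: field_simps)
    finally show ?thesis .
  qed
  have mid3: "card X \<in> {3}" if "X \<in> mid G" for X
  proof -
    from that obtain Y Z where X: "X \<in> G" "Y \<in> G" "Z \<in> G" "Y \<subset> X" "X \<subset> Z"
      by (auto simp: mid_def)
    have "finite X" "finite Z" using card[OF X(1)] card[OF X(3)] card.infinite by fastforce+
    then have "card Y < card X" "card X < card Z" using X psubset_card_mono by blast+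
    then show ?thesis using card[OF X(1)] card[OF X(2)] card[OF X(3)] by auto
  qed
  define m where "m t \<longleftrightarrow> q ` arc 8 t 3 \<in> mid G" for t
  have mI: "m t" if "y t 3" "y u 2" "arc 8 u 2 \<subseteq> arc 8 t 3" "y v 4" "arc 8 t 3 \<subseteq> arc 8 v 4"
    "t \<in> {1..8}" "u \<in> {1..8}" "v \<in> {1..8}" for t u v
    using strict[of u 2 t 3] strict[of t 3 v 4] that unfolding m_def mid_def y_def by auto
  have sub: "arc 8 1 2 \<subseteq> arc 8 1 3" "arc 8 1 2 \<subseteq> arc 8 8 3" "arc 8 8 2 \<subseteq> arc 8 7 3" "arc 8 2 2 \<subseteq> arc 8 2 3"
    "arc 8 1 3 \<subseteq> arc 8 1 4" "arc 8 1 3 \<subseteq> arc 8 8 4" "arc 8 8 3 \<subseteq> arc 8 8 4" "arc 8 8 3 \<subseteq> arc 8 7 4"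
    "arc 8 7 3 \<subseteq> arc 8 6 4" "arc 8 7 3 \<subseteq> arc 8 7 4" "arc 8 2 3 \<subseteq> arc 8 1 4" "arc 8 2 3 \<subseteq> arc 8 2 4"
    by (auto simp: arc_def)
  \<comment> \<open>The triples starting at 1 and 8 contain \<open>{1, 2}\<close>, so a quadruple
    above makes them middle sets; those starting at 7 and 2 also need \<open>{8, 1}\<close> and
    \<open>{2, 3}\<close>, respectively, as members.\<close>
  have m1: "y 1 3 \<and> (y 1 4 \<or> y 8 4) \<Longrightarrow> m 1"
    using mI[of 1 1 1] mI[of 1 1 8] y12 sub by auto
  have m8: "y 8 3 \<and> (y 8 4 \<or> y 7 4) \<Longrightarrow> m 8"
    using mI[of 8 1 8] mI[of 8 1 7] y12 sub by auto
  have m7: "y 7 3 \<and> y 8 2 \<and> (y 6 4 \<or> y 7 4) \<Longrightarrow> m 7"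
    using mI[of 7 8 6] mI[of 7 8 7] sub by auto
  have m2: "y 2 3 \<and> y 2 2 \<and> (y 1 4 \<or> y 2 4) \<Longrightarrow> m 2"
    using mI[of 2 2 1] mI[of 2 2 2] sub by auto
  \<comment> \<open>Middle sets enter the bound with a plus sign, so detecting these four is enough;
    the isolated triples need an upper bound instead.\<close>
  have sM: "(\<Sum>X\<in>mid G. 1 / 4) \<ge> 1 / 4 * (of_bool (y 1 3 \<and> (y 1 4 \<or> y 8 4)) + of_bool (y 8 3 \<and> (y 8 4 \<or> y 7 4))
      + of_bool (y 7 3 \<and> y 8 2 \<and> (y 6 4 \<or> y 7 4)) + (of_bool (y 2 3 \<and> y 2 2 \<and> (y 1 4 \<or> y 2 4)) :: real))"
  proof -
    have "(\<Sum>X\<in>mid G. 1 / 4 :: real) = (\<Sum>l\<in>{3}. \<Sum>t\<in>{1..8}. if q ` arc 8 t l \<in> mid G then 1 / 4 else 0)"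
      by (rule sum_arc_images[OF q(1)]) (use q(3) mid3 in \<open>auto simp: mid_def\<close>)
    also have "\<dots> = (\<Sum>t\<in>{1..8}. of_bool (m t) / 4)"
      by (auto simp: m_def intro!: sum.cong)
    also have "\<dots> \<ge> (\<Sum>t\<in>{1, 8, 7, 2}. of_bool (m t) / 4)"
      by (rule sum_mono2) auto
    finally have "1 / 4 * (of_bool (m 1) + of_bool (m 8) + of_bool (m 7) + of_bool (m 2)) \<le> (\<Sum>X\<in>mid G. 1 / 4 :: real)"
      by simp
    moreover have "1 / 4 * (of_bool (y 1 3 \<and> (y 1 4 \<or> y 8 4)) + of_bool (y 8 3 \<and> (y 8 4 \<or> y 7 4))
        + of_bool (y 7 3 \<and> y 8 2 \<and> (y 6 4 \<or> y 7 4)) + of_bool (y 2 3 \<and> y 2 2 \<and> (y 1 4 \<or> y 2 4)))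
      \<le> 1 / 4 * (of_bool (m 1) + of_bool (m 8) + of_bool (m 7) + of_bool (m 2) :: real)"
      by (intro mult_left_mono add_mono) (use m1 m8 m7 m2 in auto)
    ultimately show ?thesis by (rule order_trans[rotated])
  qed
  define j where "j t \<longleftrightarrow> q ` arc 8 t 3 \<in> {X \<in> isol G. card X = 3}" for t
  have jy: "y t 3" if "j t" for t using that by (auto simp: j_def isol_def y_def)
  have jn: "\<not> (y u 2 \<and> arc 8 u 2 \<subseteq> arc 8 t 3)" "\<not> (y v 4 \<and> arc 8 t 3 \<subseteq> arc 8 v 4)"
    if "j t" "t \<in> {1..8}" "u \<in> {1..8}" "v \<in> {1..8}" for t u v
    using strict[of u 2 t 3] strict[of t 3 v 4] that unfolding j_def isol_def y_def by auto
  \<comment> \<open>Triples starting at 3 to 6 miss \<open>{1, 2}\<close>, and those starting at 1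
    and 8 contain it, so only the starts 2 and 7 can give isolated triples.\<close>
  have j0: "\<not> j t" if "t \<in> {1, 3, 4, 5, 6, 8}" for t
  proof
    assume "j t"
    have "y t 3" using jy[OF \<open>j t\<close>] .
    then have "t = 1 \<or> t = 8" using none[of t 3] that by auto
    then show False using jn(1)[OF \<open>j t\<close>, of 1 1] y12 sub(1,2) by auto
  qed
  have j2: "j 2 \<Longrightarrow> y 2 3 \<and> \<not> y 2 2 \<and> \<not> y 1 4 \<and> \<not> y 2 4"
    using jy[of 2] jn[of 2 2 1] jn[of 2 2 2] sub by auto
  have j7: "j 7 \<Longrightarrow> y 7 3 \<and> \<not> y 8 2 \<and> \<not> y 6 4 \<and> \<not> y 7 4"
    using jy[of 7] jn[of 7 8 6] jn[of 7 8 7] sub by auto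
  have sI: "(\<Sum>X\<in>{X \<in> isol G. card X = 3}. 1 / real (card X))
    \<le> 1 / 3 * (of_bool (y 2 3 \<and> \<not> y 2 2 \<and> \<not> y 1 4 \<and> \<not> y 2 4) + of_bool (y 7 3 \<and> \<not> y 8 2 \<and> \<not> y 6 4 \<and> \<not> y 7 4))"
  proof -
    have "(\<Sum>X\<in>{X \<in> isol G. card X = 3}. 1 / real (card X))
      = (\<Sum>l\<in>{3}. \<Sum>t\<in>{1..8}. if q ` arc 8 t l \<in> {X \<in> isol G. card X = 3} then 1 / real (card (q ` arc 8 t l)) else 0)"
      by (rule sum_arc_images[OF q(1)]) (use q(3) in \<open>auto simp: isol_def\<close>)
    also have "\<dots> = (\<Sum>t\<in>{1..8}. of_bool (j t) / 3)"
      by (auto simp: j_def intro!: sum.cong)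
    also have "\<dots> = 1 / 3 * (of_bool (j 2) + of_bool (j 7))"
      unfolding I8 using j0 by simp
    finally have "(\<Sum>X\<in>{X \<in> isol G. card X = 3}. 1 / real (card X)) = 1 / 3 * (of_bool (j 2) + of_bool (j 7))" .
    moreover have "1 / 3 * (of_bool (j 2) + of_bool (j 7))
      \<le> 1 / 3 * (of_bool (y 2 3 \<and> \<not> y 2 2 \<and> \<not> y 1 4 \<and> \<not> y 2 4)
        + of_bool (y 7 3 \<and> \<not> y 8 2 \<and> \<not> y 6 4 \<and> \<not> y 7 4) :: real)"
      by (intro mult_left_mono add_mono) (use j2 j7 in auto)
    ultimately show ?thesis by (simp only:)
  qed
  show ?thesis
    unfolding sG
    by (rule order_trans[OF octagon_bool[OF i(1-7) b1 b2, of "y 1 3" "y 8 3"]])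
      (intro diff_mono add_mono order_refl sM sI)
qed

section \<open>Counting permutations that make given sets arcs\<close>

abbreviation perms :: "nat \<Rightarrow> (nat \<Rightarrow> nat) set" where
  "perms n \<equiv> {p. p permutes {1..n}}"

abbreviation seen :: "nat \<Rightarrow> (nat \<Rightarrow> nat) \<Rightarrow> nat set \<Rightarrow> bool" where
  "seen n p F \<equiv> F \<in> (`) p ` arcs n"

text \<open>A permutation sends at most one set onto \<open>F\<close>, so the events are
  disjoint.\<close>

lemma card_permutes_image_Bex:
  fixes U :: "'a set" and \<X> :: "'a set set"
  assumes S: "S \<subseteq> {p. p permutes U}" and fin: "finite U" "finite \<X>"
  shows "card {p \<in> S. \<exists>X\<in>\<X>. p ` X = F} = (\<Sum>X\<in>\<X>. card {p \<in> S. p ` X = F})"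
proof -
  have finS: "finite S" using finite_subset[OF S finite_permutations[OF fin(1)]] .
  have "{p \<in> S. \<exists>X\<in>\<X>. p ` X = F} = (\<Union>X\<in>\<X>. {p \<in> S. p ` X = F})" by auto
  also have "card \<dots> = (\<Sum>X\<in>\<X>. card {p \<in> S. p ` X = F})"
  proof (rule card_UN_disjoint)
    show "\<forall>X\<in>\<X>. \<forall>Y\<in>\<X>. X \<noteq> Y \<longrightarrow> {p \<in> S. p ` X = F} \<inter> {p \<in> S. p ` Y = F} = {}"
    proof (intro ballI impI)
      fix X Y :: "'a set" assume "X \<noteq> Y"
      have False if "p \<in> S" "p ` X = F" "p ` Y = F" for p
      proof -
        have "inj p" using S that(1) permutes_inj by blast
        then show False using that \<open>X \<noteq> Y\<close> inj_image_eq_iff by metis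
      qed
      then show "{p \<in> S. p ` X = F} \<inter> {p \<in> S. p ` Y = F} = {}" by blast
    qed
  qed (use fin finS in auto)
  finally show ?thesis .
qed

lemma permutes_card_image: "p permutes U \<Longrightarrow> card (p ` X) = card X"
  by (rule card_image) (rule permutes_inj_on)

lemma seen_iff:
  assumes "p permutes {1..n}"
  shows "seen n p F \<longleftrightarrow> (\<exists>X\<in>{X \<in> arcs n. card X = card F}. p ` X = F)"
proof
  assume "seen n p F"
  then obtain X where "X \<in> arcs n" "F = p ` X" by blast
  then show "\<exists>X\<in>{X \<in> arcs n. card X = card F}. p ` X = F"
    using permutes_card_image[OF assms, of X] by (intro bexI[of _ X]) simp_all
qed blast

text \<open>Splits the count by the arc that is mapped onto \<open>F\<close>; the extra event
  \<open>Q\<close> serves for conditional counts.\<close>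

lemma card_seen_and:
  fixes n :: nat
  shows "card {p \<in> perms n. seen n p F \<and> Q p}
    = (\<Sum>X\<in>{X \<in> arcs n. card X = card F}. card {p \<in> perms n. p ` X = F \<and> Q p})"
proof -
  have "{p \<in> perms n. seen n p F \<and> Q p}
      = {p \<in> {p \<in> perms n. Q p}. \<exists>X\<in>{X \<in> arcs n. card X = card F}. p ` X = F}"
    using seen_iff[of _ n F] by (intro Collect_cong) blast
  then have "card {p \<in> perms n. seen n p F \<and> Q p}
      = card {p \<in> {p \<in> perms n. Q p}. \<exists>X\<in>{X \<in> arcs n. card X = card F}. p ` X = F}"
    by (rule arg_cong)
  also have "\<dots> = (\<Sum>X\<in>{X \<in> arcs n. card X = card F}. card {p \<in> {p \<in> perms n. Q p}. p ` X = F})"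
    by (rule card_permutes_image_Bex) (use finite_arcs in auto)
  also have "\<dots> = (\<Sum>X\<in>{X \<in> arcs n. card X = card F}. card {p \<in> perms n. p ` X = F \<and> Q p})"
  proof (rule sum.cong[OF refl])
    fix X
    have "{p \<in> {p \<in> perms n. Q p}. p ` X = F} = {p \<in> perms n. p ` X = F \<and> Q p}" by blast
    then show "card {p \<in> {p \<in> perms n. Q p}. p ` X = F} = card {p \<in> perms n. p ` X = F \<and> Q p}" by simp
  qed
  finally show ?thesis .
qed

lemma card_seen_eq_sum:
  "card {p \<in> perms n. seen n p F}
    = (\<Sum>X\<in>{X \<in> arcs n. card X = card F}. card {p \<in> perms n. p ` X = F})"
  using card_seen_and[of n F "\<lambda>_. True"] by (simp only: simp_thms)

text \<open>Each of the \<open>n\<close> arcs of the right size is mapped onto \<open>F\<close> by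
  one in \<open>n choose card F\<close> of all permutations.\<close>

lemma card_seen:
  assumes F: "F \<subseteq> {1..n}" "1 \<le> card F" "card F < n"
  shows "card {p \<in> perms n. seen n p F} * (n choose card F) = n * fact n"
proof -
  have "card {p \<in> perms n. p ` X = F} * (n choose card F) = fact n"
    if X: "X \<in> arcs n" "card X = card F" for X
  proof -
    have im: "p ` X \<subseteq> {1..n}" if "p permutes {1..n}" for p
      using permutes_image[OF that] arcs_subset[OF X(1)] by blast
    have "card (perms n) = (card {1..n} choose card (F \<inter> {1..n})) * card {p \<in> perms n. p ` X = F}"
    proof (rule card_permutes_image[of "{1..n}"])
      show "p ` X - {1..n} = F - {1..n}" if "p \<in> perms n" for p
        using im that F(1) by blast
    qed (use F X permutes_compose in auto)
    moreover have "card (perms n) = fact n" by (rule card_permutations) simp_all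
    ultimately show ?thesis using F by (simp add: Int_absorb2 mult.commute)
  qed
  then have "card {p \<in> perms n. seen n p F} * (n choose card F)
      = (\<Sum>X\<in>{X \<in> arcs n. card X = card F}. fact n)"
    unfolding card_seen_eq_sum sum_distrib_right by (intro sum.cong refl) blast
  then show ?thesis using card_arcs_of_card[OF F(2,3)] by simp
qed

text \<open>Given that \<open>X\<close> is mapped onto \<open>M\<close>, permuting \<open>M\<close>
  makes all images of a fixed subarc equally likely. So each of the
  \<open>card M - card A + 1\<close> subarcs of size \<open>card A\<close> becomes \<open>A\<close>
  with probability \<open>1 / (card M choose card A)\<close>.\<close>

lemma card_image_seen_sub:
  assumes X: "X \<in> arcs n" "card X = card M" and M: "M \<subseteq> {1..n}"
    and A: "A \<subseteq> M" "1 \<le> card A"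
  shows "card {p \<in> perms n. p ` X = M \<and> seen n p A} * (card M choose card A)
    = (card M - card A + 1) * card {p \<in> perms n. p ` X = M}"
proof -
  let ?S = "{p \<in> perms n. p ` X = M}"
  let ?Y = "{Y \<in> arcs n. card Y = card A \<and> Y \<subseteq> X}"
  have finM: "finite M" using finite_subset[OF M] by simp
  have Y: "card {p \<in> ?S. p ` Y = A} * (card M choose card A) = card ?S" if "Y \<in> ?Y" for Y
  proof -
    have "card ?S = (card M choose card (A \<inter> M)) * card {p \<in> ?S. p ` Y = A}"
    proof (rule card_permutes_image[of "{1..n}"])
      fix p q assume p: "p \<in> ?S" and q: "q permutes M"
      have "q ` p ` X = M" using p permutes_image[OF q] by simp
      then have "(q \<circ> p) ` X = M" by (simp only: image_comp)
      then show "q \<circ> p \<in> ?S" using permutes_compose[of p "{1..n}" q] permutes_subset[OF q M] p by simp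
    next
      fix p assume "p \<in> ?S"
      then show "p ` Y - M = A - M" using that A by blast
    qed (use M A that in auto)
    then show ?thesis using A by (simp add: Int_absorb2 mult.commute)
  qed
  have "{p \<in> perms n. p ` X = M \<and> seen n p A} = {p \<in> ?S. \<exists>Y\<in>?Y. p ` Y = A}"
  proof (intro Collect_cong iffI; clarsimp)
    fix p Z assume p: "p permutes {Suc 0..n}" "Z \<in> arcs n" "M = p ` X" "A = p ` Z"
    then have "Z \<subseteq> X" using A inj_image_subset_iff[OF permutes_inj[OF p(1)]] by blast
    moreover have "card Z = card (p ` Z)" using permutes_card_image[OF p(1)] by simp
    ultimately show "\<exists>Y. Y \<in> arcs n \<and> card Y = card (p ` Z) \<and> Y \<subseteq> X \<and> p ` Y = p ` Z" using p by blast
  qed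
  then have "card {p \<in> perms n. p ` X = M \<and> seen n p A} = card {p \<in> ?S. \<exists>Y\<in>?Y. p ` Y = A}"
    by (rule arg_cong)
  also have "\<dots> = (\<Sum>Y\<in>?Y. card {p \<in> ?S. p ` Y = A})"
    by (rule card_permutes_image_Bex) (use finite_arcs in auto)
  finally have "card {p \<in> perms n. p ` X = M \<and> seen n p A} * (card M choose card A) = (\<Sum>Y\<in>?Y. card ?S)"
    using Y by (simp add: sum_distrib_right)
  also have "\<dots> = (card M - card A + 1) * card ?S"
    using card_subarcs[OF X(1) A(2)] card_mono[OF finM A(1)] X(2) by simp
  finally show ?thesis .
qed

text \<open>Dual of \<open>card_image_seen_sub\<close>: now the points outside \<open>M\<close> are
  permuted. \<open>S\<close> may impose further conditions that survive such permutations.\<close>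

lemma card_image_seen_super:
  assumes X: "X \<in> arcs n" "card X = card M"
    and B: "M \<subseteq> B" "B \<subseteq> {1..n}" "card B < n"
    and S: "S \<subseteq> {p \<in> perms n. p ` X = M}"
    and closed: "\<And>p q. p \<in> S \<Longrightarrow> q permutes {1..n} - M \<Longrightarrow> q \<circ> p \<in> S"
  shows "card {p \<in> S. seen n p B} * (n - card M choose (card B - card M))
    = (card B - card M + 1) * card S"
proof -
  let ?Y = "{Y \<in> arcs n. card Y = card B \<and> X \<subseteq> Y}"
  have finB: "finite B" using finite_subset[OF B(2)] by simp
  have finM: "finite M" using finite_subset[OF B(1) finB] .
  have cD: "card ({1..n} - M) = n - card M" using card_Diff_subset[OF finM, of "{1..n}"] B by auto
  have cB: "card (B - M) = card B - card M" using card_Diff_subset[OF finM B(1)] .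
  have Y: "card {p \<in> S. p ` Y = B} * (n - card M choose (card B - card M)) = card S" if Y: "Y \<in> ?Y" for Y
  proof -
    have "card S = (card ({1..n} - M) choose card (B \<inter> ({1..n} - M))) * card {p \<in> S. p ` Y = B}"
    proof (rule card_permutes_image[of "{1..n}"])
      fix p assume p: "p \<in> S"
      then have p': "p permutes {1..n}" "p ` X = M" using S by auto
      have "p ` Y \<subseteq> {1..n}" using permutes_image[OF p'(1)] Y arcs_subset by blast
      moreover have "M \<subseteq> p ` Y" using p' Y by blast
      ultimately show "p ` Y - ({1..n} - M) = B - ({1..n} - M)" using B by blast
    qed (use S B closed Y in auto)
    moreover have "B \<inter> ({1..n} - M) = B - M" using B by blast
    ultimately show ?thesis using cD cB by (simp add: mult.commute)
  qed
  have "{p \<in> S. seen n p B} = {p \<in> S. \<exists>Y\<in>?Y. p ` Y = B}"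
  proof (intro Collect_cong conj_cong refl)
    fix p assume "p \<in> S"
    then have p: "p permutes {1..n}" "p ` X = M" using S by auto
    have "X \<subseteq> Z \<and> card Z = card B" if "p ` Z = B" for Z
      using that p B(1) inj_image_subset_iff[OF permutes_inj[OF p(1)]] permutes_card_image[OF p(1)] by metis
    then show "seen n p B \<longleftrightarrow> (\<exists>Y\<in>?Y. p ` Y = B)" by blast
  qed
  then have "card {p \<in> S. seen n p B} = card {p \<in> S. \<exists>Y\<in>?Y. p ` Y = B}"
    by (rule arg_cong)
  also have "\<dots> = (\<Sum>Y\<in>?Y. card {p \<in> S. p ` Y = B})"
    by (rule card_permutes_image_Bex) (use S finite_arcs in auto)
  finally have "card {p \<in> S. seen n p B} * (n - card M choose (card B - card M)) = (\<Sum>Y\<in>?Y. card S)"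
    using Y by (simp add: sum_distrib_right)
  also have "\<dots> = (card B - card M + 1) * card S"
    using card_superarcs[OF X(1) _ B(3)] card_mono[OF finB B(1)] X(2) by simp
  finally show ?thesis .
qed

lemma card_seen_sub:
  assumes M: "M \<subseteq> {1..n}" and A: "A \<subseteq> M" "1 \<le> card A"
  shows "card {p \<in> perms n. seen n p M \<and> seen n p A} * (card M choose card A)
    = (card M - card A + 1) * card {p \<in> perms n. seen n p M}"
  unfolding card_seen_and[of n M "\<lambda>p. seen n p A"] card_seen_eq_sum
    sum_distrib_right sum_distrib_left
proof (rule sum.cong[OF refl])
  fix X assume "X \<in> {X \<in> arcs n. card X = card M}"
  then show "card {p \<in> perms n. p ` X = M \<and> seen n p A} * (card M choose card A)
      = (card M - card A + 1) * card {p \<in> perms n. p ` X = M}"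
    by (intro card_image_seen_sub M A) simp_all
qed

text \<open>\<open>Q\<close> is taken either trivial or as a subset of \<open>M\<close> being seen;
  the latter shows that, given \<open>M\<close>, a subset and a superset are seen
  independently.\<close>

lemma card_seen_super:
  assumes B: "M \<subseteq> B" "B \<subseteq> {1..n}" "card B < n"
    and Q: "\<And>p q. Q p \<Longrightarrow> q permutes {1..n} - M \<Longrightarrow> Q (q \<circ> p)"
  shows "card {p \<in> perms n. seen n p M \<and> Q p \<and> seen n p B} * (n - card M choose (card B - card M))
    = (card B - card M + 1) * card {p \<in> perms n. seen n p M \<and> Q p}"
  unfolding card_seen_and[of n M "\<lambda>p. Q p \<and> seen n p B"] card_seen_and[of n M Q]
    sum_distrib_right sum_distrib_left
proof (rule sum.cong[OF refl])
  fix X assume "X \<in> {X \<in> arcs n. card X = card M}"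
  then have X: "X \<in> arcs n" "card X = card M" by simp_all
  let ?S = "{p \<in> perms n. p ` X = M \<and> Q p}"
  have "card {p \<in> ?S. seen n p B} * (n - card M choose (card B - card M))
    = (card B - card M + 1) * card ?S"
  proof (rule card_image_seen_super[OF X B])
    fix p q assume p: "p \<in> ?S" and q: "q permutes {1..n} - M"
    have "q permutes {1..n}" using permutes_subset[OF q] by blast
    \<comment> \<open>The image of \<open>X\<close> is \<open>M\<close>, and \<open>q\<close> fixes
      every point of \<open>M\<close>.\<close>
    moreover have "q ` p ` X = p ` X"
      using p q by (intro image_cong[of _ _ q id, simplified]) (auto simp: permutes_def)
    ultimately show "q \<circ> p \<in> ?S"
      using p Q[OF _ q] permutes_compose[of p "{1..n}" q] by (simp add: image_comp)
  qed blast
  moreover have "{p \<in> ?S. seen n p B} = {p \<in> perms n. p ` X = M \<and> Q p \<and> seen n p B}" by blast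
  ultimately show "card {p \<in> perms n. p ` X = M \<and> Q p \<and> seen n p B} * (n - card M choose (card B - card M))
    = (card B - card M + 1) * card ?S" by (simp only:)
qed

text \<open>Supplies the condition on \<open>Q\<close> in \<open>card_seen_super\<close>:
  \<open>q\<close> moves no point of \<open>A\<close>.\<close>

lemma seen_comp:
  assumes "seen n p A" "A \<subseteq> M" "q permutes {1..n} - M"
  shows "seen n (q \<circ> p) A"
proof -
  obtain Z where Z: "Z \<in> arcs n" "A = p ` Z" using assms(1) by blast
  have "q x = x" if "x \<in> A" for x
    using assms(2,3) that permutes_not_in[of q "{1..n} - M" x] by blast
  then have "A = (q \<circ> p) ` Z" unfolding Z(2) by force
  then show ?thesis using Z(1) by blast
qed

section \<open>Binomial estimates for the conditional probabilities\<close>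

text \<open>Equality holds at \<open>b = 2\<close>. Raising \<open>b\<close> by 1 multiplies the
  left side by \<open>b + 1\<close> and the right side by \<open>a + b - 1\<close>, which is no
  smaller since \<open>a \<ge> 2\<close>.\<close>

lemma fact_mult_fact_le:
  assumes "2 \<le> a" "2 \<le> b"
  shows "fact a * fact b \<le> (2 * fact (a + b - 2) :: nat)"
  using assms(2)
proof (induction b rule: dec_induct)
  case base
  then show ?case by (simp add: numeral_2_eq_2)
next
  case (step b)
  obtain c where c: "a + b - 2 = c" "a + Suc b - 2 = Suc c" using assms(1) by (auto simp: Suc_diff_le)
  have "fact a * fact (Suc b) = Suc b * (fact a * fact b :: nat)" by (simp only: fact_Suc of_nat_id mult.left_commute)
  also have "\<dots> \<le> Suc b * (2 * fact c)" using step.IH c by (intro mult_le_mono2) simp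
  also have "\<dots> \<le> Suc c * (2 * fact c)" using assms(1) c by (intro mult_le_mono1) simp
  also have "\<dots> = 2 * fact (Suc c)" by (simp only: fact_Suc of_nat_id mult.left_commute)
  finally show ?case using c by simp
qed

text \<open>Bounds the conditional probability \<open>(d + 1) / (m choose d)\<close> by
  \<open>2 / m\<close>. Clearing factorials reduces this to \<open>fact_mult_fact_le\<close> for
  \<open>d + 1\<close> and \<open>m - d\<close>.\<close>

lemma mult_Suc_le_choose:
  assumes "1 \<le> d" "d + 2 \<le> m"
  shows "m * (d + 1) \<le> 2 * (m choose d)"
proof -
  have "m * (d + 1) * (fact d * fact (m - d)) = m * (fact (d + 1) * fact (m - d))"
    by (simp add: algebra_simps)
  also have "\<dots> \<le> m * (2 * fact (m - 1))"
    using fact_mult_fact_le[of "d + 1" "m - d"] assms by (intro mult_le_mono2) simp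
  also have "\<dots> = 2 * fact m"
    using assms by (simp add: fact_reduce[of m])
  also have "\<dots> = 2 * (m choose d) * (fact d * fact (m - d))"
    using binomial_fact_lemma[of d m] assms by (simp add: mult.commute mult.left_commute)
  finally have "m * (d + 1) * (fact d * fact (m - d)) \<le> 2 * (m choose d) * (fact d * fact (m - d) :: nat)" .
  then show ?thesis by (simp only: mult_le_cancel2) simp
qed

text \<open>With \<open>d\<close> points of \<open>M\<close> outside \<open>A\<close>, the exact
  value from \<open>card_seen_sub\<close> is estimated by \<open>mult_Suc_le_choose\<close>;
  \<open>card A \<ge> 2\<close> gives \<open>d + 2 \<le> card M\<close>.\<close>

lemma card_seen_sub_le:
  assumes M: "M \<subseteq> {1..n}" and A: "A \<subset> M" "2 \<le> card A"
  shows "card M * card {p \<in> perms n. seen n p M \<and> seen n p A} \<le> 2 * card {p \<in> perms n. seen n p M}"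
proof -
  have "card A < card M" using A M by (meson finite_atLeastAtMost finite_subset psubset_card_mono)
  define d where "d = card M - card A"
  have C: "card M choose card A = card M choose d"
    using binomial_symmetric[of "card A" "card M"] \<open>card A < card M\<close> by (simp add: d_def)
  let ?N = "card {p \<in> perms n. seen n p M}" and ?A = "card {p \<in> perms n. seen n p M \<and> seen n p A}"
  have "(d + 1) * (card M * ?A) = card M * (d + 1) * ?A" by (simp only: mult_ac)
  also have "\<dots> \<le> 2 * (card M choose d) * ?A"
    using mult_Suc_le_choose[of d "card M"] \<open>card A < card M\<close> A(2) by (intro mult_le_mono1) (simp add: d_def)
  also have "\<dots> = 2 * (?A * (card M choose d))" by (simp only: mult_ac)
  also have "?A * (card M choose d) = (d + 1) * ?N"
    using card_seen_sub[OF M psubset_imp_subset[OF A(1)]] A(2) C by (simp add: d_def)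
  also have "2 * \<dots> = (d + 1) * (2 * ?N)" by (simp only: mult_ac)
  finally show ?thesis by (simp only: mult_le_cancel1)
qed

text \<open>The same estimate in the complement of \<open>M\<close>; the two points left outside
  \<open>B\<close> give \<open>d + 2 \<le> n - card M\<close>.\<close>

lemma card_seen_super_le:
  assumes B: "M \<subset> B" "B \<subseteq> {1..n}" "card B + 2 \<le> n"
  shows "(n - card M) * card {p \<in> perms n. seen n p M \<and> seen n p B} \<le> 2 * card {p \<in> perms n. seen n p M}"
proof -
  have "card M < card B" using B by (meson finite_atLeastAtMost finite_subset psubset_card_mono)
  define d where "d = card B - card M"
  let ?N = "card {p \<in> perms n. seen n p M}" and ?B = "card {p \<in> perms n. seen n p M \<and> seen n p B}"
  have "(d + 1) * ((n - card M) * ?B) = (n - card M) * (d + 1) * ?B" by (simp only: mult_ac)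
  also have "\<dots> \<le> 2 * (n - card M choose d) * ?B"
    using mult_Suc_le_choose[of d "n - card M"] \<open>card M < card B\<close> B(3) by (intro mult_le_mono1) (simp add: d_def)
  also have "\<dots> = 2 * (?B * (n - card M choose d))" by (simp only: mult_ac)
  also have "?B * (n - card M choose d) = (d + 1) * ?N"
    using card_seen_super[OF psubset_imp_subset[OF B(1)] B(2), of "\<lambda>_. True"] B(3) by (simp add: d_def)
  also have "2 * \<dots> = (d + 1) * (2 * ?N)" by (simp only: mult_ac)
  finally show ?thesis by (simp only: mult_le_cancel1)
qed

section \<open>Averaging over all cycles\<close>

lemma butterfly_free_subset: "butterfly_free F \<Longrightarrow> G \<subseteq> F \<Longrightarrow> butterfly_free G"
  unfolding butterfly_free_def by (meson subsetD)

theorem theorem11: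
  fixes n :: nat and \<F> :: "nat set set"
  assumes "\<F> \<subseteq> Pow {1..n}"
    and "intersecting \<F>"
    and "butterfly_free \<F>"
    and "\<And>F. F \<in> \<F> \<Longrightarrow> 2 \<le> card F \<and> real (card F) \<le> real n / 2"
  shows "(\<Sum>F\<in>\<F>. 1 / real ((n - 1) choose (card F - 1))) \<le> 2"
proof -
  have fin: "finite \<F>" using finite_subset[OF assms(1)] by simp
  have size: "2 \<le> card F" "2 * card F \<le> n" "F \<subseteq> {1..n}" "finite F" if "F \<in> \<F>" for F
    using assms(4)[OF that] assms(1) that finite_subset[of F "{1..n}"] by auto
  define M where "M = mid \<F>"
  have finM: "finite M" and MF: "M \<subseteq> \<F>" using fin by (auto simp: M_def mid_def)
  have "\<exists>Y Z. Y \<in> \<F> \<and> Z \<in> \<F> \<and> Y \<subset> m \<and> m \<subset> Z" if "m \<in> M" for m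
    using that by (auto simp: M_def mid_def)
  then obtain lo hi where lh: "\<And>m. m \<in> M \<Longrightarrow> lo m \<in> \<F> \<and> hi m \<in> \<F> \<and> lo m \<subset> m \<and> m \<subset> hi m"
    by metis
  have butterfly: False
    if "A \<in> \<F>" "B \<in> \<F>" "C \<in> \<F>" "D \<in> \<F>" "distinct [A, B, C, D]"
      "A \<subseteq> C" "B \<subseteq> C" "A \<subseteq> D" "B \<subseteq> D" for A B C D
    using assms(3) that unfolding butterfly_free_def by blast
  \<comment> \<open>Otherwise \<open>Y\<close> and \<open>lo m\<close> would both lie below
    \<open>m\<close> and \<open>hi m\<close>.\<close>
  have lo_unique: "Y = lo m" if m: "m \<in> M" and Y: "Y \<in> \<F>" "Y \<subset> m" for m Y
  proof (rule ccontr)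
    assume "Y \<noteq> lo m"
    then show False using butterfly[of Y "lo m" m "hi m"] lh[OF m] Y m MF by auto
  qed
  \<comment> \<open>Otherwise \<open>lo m\<close> and \<open>m\<close> would both lie below
    \<open>Z\<close> and \<open>hi m\<close>. This is a butterfly in the weak sense, as
    \<open>lo m \<subset> m\<close>.\<close>
  have hi_unique: "Z = hi m" if m: "m \<in> M" and Z: "Z \<in> \<F>" "m \<subset> Z" for m Z
  proof (rule ccontr)
    assume "Z \<noteq> hi m"
    then show False using butterfly[of m "lo m" Z "hi m"] lh[OF m] Z m MF by auto
  qed
  have card_lt: "card (lo m) < card m" "card m < card (hi m)" if "m \<in> M" for m
    using lh[OF that] size(4) that MF psubset_card_mono by blast+
  \<comment> \<open>\<open>\<alpha> m\<close> is the cost of an excess, with the value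
    \<open>1 / 4\<close> coming from \<open>octagon_sum_le\<close>; \<open>c m p\<close> is then the
    excess minus the gain of \<open>m\<close> on the cycle given by \<open>p\<close>.\<close>
  define \<alpha> where "\<alpha> m = (if n = 8 then 1 / 4 else 1 / real (card m))" for m :: "nat set"
  define N where "N Q = real (card {p \<in> perms n. Q p})" for Q
  define c where "c m p = \<alpha> m * of_bool (seen n p m \<and> seen n p (lo m) \<and> seen n p (hi m))
      - 1 / real (card m) * of_bool (seen n p m \<and> \<not> seen n p (lo m) \<and> \<not> seen n p (hi m))" for m p

  have cycle: "(\<Sum>F\<in>{F \<in> \<F>. seen n p F}. 1 / real (card F)) \<le> 2 + (\<Sum>m\<in>M. c m p)"
    if p: "p permutes {1..n}" for p
  proof -
    define G where "G = {F \<in> \<F>. seen n p F}"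
    have G: "G \<subseteq> (`) p ` arcs n" "G \<subseteq> \<F>" by (auto simp: G_def)
    have inj: "inj_on p {1..n}" using permutes_inj_on[OF p] .
    have int: "intersecting G" using intersecting_subset[OF assms(2) G(2)] .
    have half: "2 * card F \<le> n" if "F \<in> G" for F using size(2) that G(2) by blast
    have finG: "finite G" using finite_subset[OF G(2) fin] .
    let ?m = "{m \<in> M. seen n p m \<and> seen n p (lo m) \<and> seen n p (hi m)}"
    let ?i = "{m \<in> M. seen n p m \<and> \<not> seen n p (lo m) \<and> \<not> seen n p (hi m)}"
    have midG: "mid G = ?m"
    proof
      show "?m \<subseteq> mid G"
      proof
        fix m assume m: "m \<in> ?m"
        then have "m \<in> M" by simp
        have "m \<in> G" "lo m \<in> G" "hi m \<in> G" using m lh[OF \<open>m \<in> M\<close>] MF by (auto simp: G_def)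
        then show "m \<in> mid G" using lh[OF \<open>m \<in> M\<close>] unfolding mid_def by blast
      qed
      show "mid G \<subseteq> ?m"
      proof
        fix m assume m: "m \<in> mid G"
        then obtain Y Z where YZ: "Y \<in> G" "Z \<in> G" "Y \<subset> m" "m \<subset> Z" "m \<in> G" by (auto simp: mid_def)
        then have F: "Y \<in> \<F>" "Z \<in> \<F>" "m \<in> \<F>" using G(2) by auto
        then have M: "m \<in> M" unfolding M_def mid_def using YZ(3,4) by blast
        have "Y = lo m" "Z = hi m"
          using lo_unique[OF M F(1) YZ(3)] hi_unique[OF M F(2) YZ(4)] .
        then show "m \<in> ?m" using YZ M by (simp add: G_def)
      qed
    qed
    \<comment> \<open>One inclusion suffices: members outside \<open>M\<close> may be isolated in
      \<open>G\<close> as well, and their gain is given away.\<close>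
    have isolG: "?i \<subseteq> isol G"
    proof
      fix m assume m: "m \<in> ?i"
      then have mM: "m \<in> M" and un: "\<not> seen n p (lo m)" "\<not> seen n p (hi m)" by blast+
      have "m \<in> G" using m MF unfolding G_def by blast
      moreover have "\<not> Y \<subset> m" if "Y \<in> G" for Y
        using lo_unique[OF mM, of Y] un(1) that unfolding G_def by blast
      moreover have "\<not> m \<subset> Z" if "Z \<in> G" for Z
        using hi_unique[OF mM, of Z] un(2) that unfolding G_def by blast
      ultimately show "m \<in> isol G" unfolding isol_def by blast
    qed
    \<comment> \<open>\<open>I\<close> collects the isolated members whose gain is available: all of
      them in general, only the triples when \<open>n = 8\<close>. Sets in \<open>M\<close> are
      triples in that case.\<close>
    obtain I where I: "?i \<subseteq> I" "finite I"
      and le: "(\<Sum>X\<in>G. 1 / real (card X)) \<le> 2 + (\<Sum>X\<in>mid G. \<alpha> X) - (\<Sum>X\<in>I. 1 / real (card X))"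
    proof (cases "n = 8")
      case False
      have "finite (isol G)" using finG by (simp add: isol_def)
      then show ?thesis
        using that[OF isolG] arcs_sum_le[OF inj G(1) int half] False by (simp add: \<alpha>_def)
    next
      case True
      have "card X \<in> {2, 3, 4}" if "X \<in> G" for X
      proof -
        have "2 \<le> card X" "card X \<le> 4" using size(1,2)[of X] that G(2) True by auto
        then show ?thesis by auto
      qed
      then have "(\<Sum>X\<in>G. 1 / real (card X))
          \<le> 2 + (\<Sum>X\<in>mid G. 1 / 4) - (\<Sum>X\<in>{X \<in> isol G. card X = 3}. 1 / real (card X))"
        using octagon_sum_le[of p G] inj G(1) int butterfly_free_subset[OF assms(3) G(2)] True by simp
      moreover have "?i \<subseteq> {X \<in> isol G. card X = 3}"
      proof -
        have "card m = 3" if "m \<in> M" for m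
          using card_lt[OF that] size(1)[of "lo m"] size(2)[of "hi m"] lh[OF that] True by auto
        then show ?thesis using isolG by blast
      qed
      moreover have "finite {X \<in> isol G. card X = 3}" using finG by (simp add: isol_def)
      ultimately show ?thesis using that True by (simp add: \<alpha>_def)
    qed
    have "(\<Sum>X\<in>?i. 1 / real (card X)) \<le> (\<Sum>X\<in>I. 1 / real (card X))"
      by (rule sum_mono2[OF I(2,1)]) simp
    moreover have "(\<Sum>m\<in>M. c m p) = (\<Sum>X\<in>?m. \<alpha> X) - (\<Sum>X\<in>?i. 1 / real (card X))"
      unfolding c_def sum_subtractf sum.inter_filter[OF finM]
      by (intro arg_cong2[where f = minus] sum.cong refl) auto
    ultimately show ?thesis using le midG by (simp add: G_def)
  qed

  have N_sum: "(\<Sum>p\<in>perms n. of_bool (Q p)) = N Q" for Q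
    using finite_permutations[of "{1..n}"] by (simp add: N_def Int_def)
  have average: "(\<Sum>p\<in>perms n. c m p) \<le> 0" if m: "m \<in> M" for m
  proof -
    let ?a = "lo m" and ?b = "hi m"
    have ab: "?a \<in> \<F>" "?b \<in> \<F>" "?a \<subset> m" "m \<subset> ?b" "m \<in> \<F>" using lh[OF m] m MF by auto
    have sz: "2 \<le> card ?a" "card ?a < card m" "card m < card ?b" "2 * card ?b \<le> n"
      using size[OF ab(1)] size[OF ab(2)] card_lt[OF m] by auto
    let ?N = "N (\<lambda>p. seen n p m)" and ?Na = "N (\<lambda>p. seen n p m \<and> seen n p ?a)"
      and ?Nb = "N (\<lambda>p. seen n p m \<and> seen n p ?b)"
      and ?Nab = "N (\<lambda>p. seen n p m \<and> seen n p ?a \<and> seen n p ?b)"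
    \<comment> \<open>The indicator that \<open>m\<close> is seen but neither neighbour is, expanded
      by inclusion-exclusion.\<close>
    have "c m p = \<alpha> m * of_bool (seen n p m \<and> seen n p ?a \<and> seen n p ?b)
        - 1 / real (card m) * (of_bool (seen n p m) - of_bool (seen n p m \<and> seen n p ?a)
          - of_bool (seen n p m \<and> seen n p ?b) + of_bool (seen n p m \<and> seen n p ?a \<and> seen n p ?b))" for p
      unfolding c_def by (cases "seen n p m"; cases "seen n p ?a"; cases "seen n p ?b") simp_all
    then have eq: "(\<Sum>p\<in>perms n. c m p)
        = \<alpha> m * ?Nab - 1 / real (card m) * (?N - ?Na - ?Nb + ?Nab)"
      by (simp only: sum_subtractf sum.distrib sum_distrib_left[symmetric] N_sum)
    have Na: "card m * ?Na \<le> 2 * ?N"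
    proof -
      have "real (card m * card {p \<in> perms n. seen n p m \<and> seen n p ?a}) \<le> real (2 * card {p \<in> perms n. seen n p m})"
        using card_seen_sub_le[OF size(3)[OF ab(5)] ab(3) sz(1)] by (simp only: of_nat_le_iff)
      then show ?thesis by (simp add: N_def)
    qed
    have Nb: "(n - card m) * ?Nb \<le> 2 * ?N"
    proof -
      have "real ((n - card m) * card {p \<in> perms n. seen n p m \<and> seen n p ?b}) \<le> real (2 * card {p \<in> perms n. seen n p m})"
        using card_seen_super_le[OF ab(4) size(3)[OF ab(2)]] sz by (simp only: of_nat_le_iff)
      then show ?thesis by (simp only: N_def of_nat_mult of_nat_numeral)
    qed
    show ?thesis
    proof (cases "n = 8")
      case False
      \<comment> \<open>The sizes force \<open>n \<ge> 8\<close>, so here \<open>n \<ge> 9\<close>,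
        and \<open>card m < n / 2\<close> by at least 1. The bounds \<open>2 / 3\<close> and
        \<open>2 / 6\<close> add up to exactly 1, and \<open>?Nab\<close> cancels because
        \<open>\<alpha> m = 1 / card m\<close>.\<close>
      have "3 \<le> card m" "6 \<le> n - card m" using sz False by auto
      then have "3 * ?Na \<le> card m * ?Na" "6 * ?Nb \<le> (n - card m) * ?Nb"
        by (auto intro!: mult_right_mono simp: N_def)
      then have "0 \<le> ?N - ?Na - ?Nb" using Na Nb by linarith
      then have "0 \<le> 1 / real (card m) * (?N - ?Na - ?Nb)" by simp
      then show ?thesis using eq False by (simp add: \<alpha>_def algebra_simps)
    next
      case True
      have sizes: "card m = 3" "card ?a = 2" "card ?b = 4" using sz True by auto
      \<comment> \<open>For \<open>n = 8\<close> the estimates only give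
        \<open>2 / 3 + 2 / 5 > 1\<close>, so exact counts are used. Given \<open>m\<close>, seeing
        \<open>lo m\<close> concerns only the order inside \<open>m\<close>, so \<open>hi m\<close>
        still has probability \<open>2 / 5\<close>.\<close>
      have "card {p \<in> perms n. seen n p m \<and> seen n p ?a \<and> seen n p ?b} * (n - card m choose (card ?b - card m))
          = (card ?b - card m + 1) * card {p \<in> perms n. seen n p m \<and> seen n p ?a}"
        using ab(3) sz by (intro card_seen_super[OF psubset_imp_subset[OF ab(4)] size(3)[OF ab(2)]] seen_comp[where M = m]) auto
      then have "5 * card {p \<in> perms n. seen n p m \<and> seen n p ?a \<and> seen n p ?b}
          = 2 * card {p \<in> perms n. seen n p m \<and> seen n p ?a}"
        by (simp only: sizes True) simp
      then have Nab: "5 * ?Nab = 2 * ?Na"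
        unfolding N_def by (metis (mono_tags) of_nat_mult of_nat_numeral)
      have "card {p \<in> perms n. seen n p m \<and> seen n p ?a} * (card m choose card ?a)
          = (card m - card ?a + 1) * card {p \<in> perms n. seen n p m}"
        using sz by (intro card_seen_sub[OF size(3)[OF ab(5)] psubset_imp_subset[OF ab(3)]]) auto
      then have "3 * card {p \<in> perms n. seen n p m \<and> seen n p ?a} = 2 * card {p \<in> perms n. seen n p m}"
        by (simp only: sizes) (simp add: choose_two)
      then have Na': "3 * ?Na = 2 * ?N"
        unfolding N_def by (metis (mono_tags) of_nat_mult of_nat_numeral)
      \<comment> \<open>In units of \<open>?N\<close>: \<open>?Na\<close> is \<open>2 / 3\<close>,
        \<open>?Nab\<close> is \<open>4 / 15\<close> and \<open>?Nb\<close> is at most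
        \<open>2 / 5\<close>, so the total is at most
        \<open>1 / 4 * 4 / 15 - 1 / 3 * 1 / 5 = 0\<close>.\<close>
      have "5 * ?Nb \<le> 2 * ?N" using Nb sizes True by simp
      then show ?thesis using eq True sizes Nab Na' by (simp add: \<alpha>_def)
    qed
  qed

  have weight: "1 / real (card F) * N (\<lambda>p. seen n p F) = fact n * (1 / real ((n - 1) choose (card F - 1)))"
    if F: "F \<in> \<F>" for F
  proof -
    let ?k = "card F"
    have k: "2 \<le> ?k" "?k < n" using size[OF F] by auto
    have "card {p \<in> perms n. seen n p F} * (n choose ?k) = n * fact n"
      using size[OF F] by (intro card_seen) auto
    then have "card {p \<in> perms n. seen n p F} * (?k * (n choose ?k)) = ?k * (n * fact n)"
      by (simp only: mult.left_commute)
    \<comment> \<open>Absorption turns the mean weight \<open>n / (?k * (n choose ?k))\<close> into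
      the reciprocal binomial of the claim.\<close>
    moreover have "?k * (n choose ?k) = n * ((n - 1) choose (?k - 1))"
      using k by (intro times_binomial_minus1_eq) simp
    ultimately have "card {p \<in> perms n. seen n p F} * ((n - 1) choose (?k - 1)) = ?k * fact n"
      using k by simp
    then have "N (\<lambda>p. seen n p F) * real ((n - 1) choose (?k - 1)) = real ?k * fact n"
      unfolding N_def by (metis (mono_tags) of_nat_mult of_nat_fact)
    moreover have "real ((n - 1) choose (?k - 1)) > 0" using k by (simp add: binomial_eq_0_iff)
    ultimately show ?thesis using k by (simp add: field_simps)
  qed
  \<comment> \<open>Double counting of the pairs of a member and a permutation for which it is seen,
    weighted by \<open>1 / card F\<close>.\<close>
  have "fact n * (\<Sum>F\<in>\<F>. 1 / real ((n - 1) choose (card F - 1)))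
      = (\<Sum>F\<in>\<F>. 1 / real (card F) * (\<Sum>p\<in>perms n. of_bool (seen n p F)))"
    unfolding sum_distrib_left N_sum by (rule sum.cong[OF refl]) (simp only: weight)
  also have "\<dots> = (\<Sum>p\<in>perms n. \<Sum>F\<in>\<F>. 1 / real (card F) * of_bool (seen n p F))"
    unfolding sum_distrib_left by (rule sum.swap)
  also have "\<dots> = (\<Sum>p\<in>perms n. \<Sum>F\<in>{F \<in> \<F>. seen n p F}. 1 / real (card F))"
    unfolding sum.inter_filter[OF fin] by (intro sum.cong refl) auto
  also have "\<dots> \<le> (\<Sum>p\<in>perms n. 2 + (\<Sum>m\<in>M. c m p))"
    by (rule sum_mono) (use cycle in blast)
  also have "\<dots> = 2 * fact n + (\<Sum>m\<in>M. \<Sum>p\<in>perms n. c m p)"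
  proof -
    have "card (perms n) = fact n" by (rule card_permutations) simp_all
    then show ?thesis by (simp add: sum.distrib sum.swap[of _ M])
  qed
  also have "\<dots> \<le> 2 * fact n"
    using sum_nonpos[of M "\<lambda>m. \<Sum>p\<in>perms n. c m p"] average by simp
  finally show ?thesis by simp
qed

end
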